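(* Let $N_h=\dim V_h$, let $\phi_1,\dots,\phi_{N_h}$ be the nodal basis of $V_h$ and let $\mathbf M$ be the mass matrix, $\mathbf M_{jk}=(\phi_j,\phi_k)$. For $0\le\ell\le N_h-1$ write $\mathbf M=\mathbf D_\ell+\mathbf R_\ell$, where $\mathbf D_\ell$ contains the entries of $\mathbf M$ within bandwidth $\ell$ (the entries $\mathbf M_{jk}$ with $|j-k|\le\ell$, all other entries being zero) and $\mathbf R_\ell$ is the remainder. Let $\mathcal L$ be the mass-lumping operator, $\mathcal L(\mathbf B)_{mn}=\delta_{mn}\sum_{k=1}^{N_h}\mathbf B_{mk}$ for $\mathbf B\in\mathbb R^{N_h\times N_h}$, with $\delta_{mn}$ the Kronecker delta, and define $\mathbf M_\ell=\mathbf D_\ell+\mathcal L(\mathbf R_\ell)$. Then, for $0\le\ell\le N_h-1$, $$\langle\chi,\psi\rangle_\ell=[\chi]^T\mathbf M_\ell[\psi],\qquad\chi,\psi\in V_h,$$ where $[\chi]\in\mathbb R^{N_h}$ is the coordinate vector of $\chi$ in the nodal basis, defines an admissible inner product on $V_h$; that is, it is an inner product and, with $\|\chi\|_\ell=\langle\chi,\chi\rangle_\ell^{1/2}$, uniformly in $h$: (i) $|(\chi,\psi)-\langle\chi,\psi\rangle_\ell|\lesssim h^2|\chi|_1|\psi|_1$ for all $\chi,\psi\in V_h$; (ii) $\|\chi\|_\ell\simeq\|\chi\|$ for all $\chi\in V_h$.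
   Context: Setting: $d\in\{1,2,3\}$; $\mathcal S\subset\mathbb R^d$ is a bounded convex (open) interval, polygon or polyhedron. $(\cdot,\cdot)$, $\|\cdot\|$ are the $L^2(\mathcal S)$ inner product and norm, $|v|_1=\|\nabla v\|$. Mesh: $\{\mathcal T_h\}_{h\downarrow0}$ is a family of conforming simplicial triangulations of $\overline{\mathcal S}$, $h=\max_Kh_K$, $h_K=\operatorname{diam}K$, shape regular (there is $\sigma_{\rm sr}>0$ with $\rho_K\ge\sigma_{\rm sr}h_K$ for all $K\in\mathcal T_h$ and all $h$, $\rho_K$ the diameter of the largest ball in $K$). Either homogeneous Dirichlet or homogeneous Neumann boundary conditions are considered; the active vertices $\mathcal Z_h^{\rm act}$ are the vertices not on $\partial\mathcal S$ in the Dirichlet case and all vertices in the Neumann case. $V_h$ is the span of the continuous piecewise affine nodal basis functions associated with the active vertices (in some enumeration). $X\lesssim Y$ means $X\le CY$ with $C$ independent of $h$; $X\simeq Y$ means $X\lesssim Y\lesssim X$. *)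

theory Defs
  imports
    "HOL-Analysis.Analysis"
    "HOL-Library.Function_Algebras"
    "Jordan_Normal_Form.Matrix"
begin

unbundle no vec_syntax

(* \<nabla>v is the classical pointwise gradient. Piecewise affine functions on a triangulation have
   one off the skeleton, a null set, and for continuous ones it represents the weak gradient. *)
definition grad :: "('a::euclidean_space \<Rightarrow> real) \<Rightarrow> 'a \<Rightarrow> 'a"
  where "grad v x = (THE g. GDERIV v x :> g)"

definition l2_inner :: "'a::euclidean_space set \<Rightarrow> ('a \<Rightarrow> real) \<Rightarrow> ('a \<Rightarrow> real) \<Rightarrow> real"
  where "l2_inner S u v = (LINT x:S|lebesgue. u x * v x)"

definition l2_norm :: "'a::euclidean_space set \<Rightarrow> ('a \<Rightarrow> real) \<Rightarrow> real"
  where "l2_norm S v = sqrt (l2_inner S v v)"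

definition h1_seminorm :: "'a::euclidean_space set \<Rightarrow> ('a \<Rightarrow> real) \<Rightarrow> real"
  where "h1_seminorm S v = sqrt (LINT x:S|lebesgue. (norm (grad v x))\<^sup>2)"

(* A mesh is the set of its closed full-dimensional cells only, without their lower-dimensional
   faces; conformity is the intersection condition in triangulation. *)
definition conforming_mesh :: "'a::euclidean_space set \<Rightarrow> 'a set set \<Rightarrow> bool"
  where "conforming_mesh S T \<longleftrightarrow>
    triangulation T \<and> (\<forall>K\<in>T. int DIM('a) simplex K) \<and> \<Union>T = closure S"

definition mesh_size :: "'a::euclidean_space set set \<Rightarrow> real"
  where "mesh_size T = Max (diameter ` T)"

definition inball_diameter :: "'a::euclidean_space set \<Rightarrow> real"
  where "inball_diameter K = Sup {diameter (cball x r) | x r. cball x r \<subseteq> K}"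

definition shape_regular :: "'i set \<Rightarrow> ('i \<Rightarrow> 'a::euclidean_space set set) \<Rightarrow> bool"
  where "shape_regular H T \<longleftrightarrow>
    (\<exists>\<sigma>>0. \<forall>h\<in>H. \<forall>K\<in>T h. inball_diameter K \<ge> \<sigma> * diameter K)"

definition mesh_vertices :: "'a::euclidean_space set set \<Rightarrow> 'a set"
  where "mesh_vertices T = {z. \<exists>K\<in>T. z extreme_point_of K}"

datatype boundary_condition = Dirichlet | Neumann

fun active_vertices :: "boundary_condition \<Rightarrow> 'a::euclidean_space set \<Rightarrow> 'a set set \<Rightarrow> 'a set"
  where
    "active_vertices Dirichlet S T = mesh_vertices T - frontier S"
  | "active_vertices Neumann S T = mesh_vertices T"

(* Functions on the closed domain are represented as total functions vanishing outside it, so that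
   equality of functions is equality on the closed domain. *)
definition nodal_function :: "'a::euclidean_space set set \<Rightarrow> 'a \<Rightarrow> 'a \<Rightarrow> real"
  where "nodal_function T z = (THE \<phi>.
     continuous_on (\<Union>T) \<phi> \<and>
     (\<forall>K\<in>T. \<exists>a b. \<forall>x\<in>K. \<phi> x = inner a x + b) \<and>
     (\<forall>z'\<in>mesh_vertices T. \<phi> z' = (if z' = z then 1 else 0)) \<and>
     (\<forall>x. x \<notin> \<Union>T \<longrightarrow> \<phi> x = 0))"

global_interpretation fun_space: vector_space "\<lambda>(c::real) (f::'a \<Rightarrow> real) x. c * f x"
  by unfold_locales (auto simp: fun_eq_iff algebra_simps)

definition fe_space ::
    "boundary_condition \<Rightarrow> 'a::euclidean_space set \<Rightarrow> 'a set set \<Rightarrow> ('a \<Rightarrow> real) set"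
  where "fe_space bc S T = fun_space.span (nodal_function T ` active_vertices bc S T)"

definition fe_dim :: "boundary_condition \<Rightarrow> 'a::euclidean_space set \<Rightarrow> 'a set set \<Rightarrow> nat"
  where "fe_dim bc S T = fun_space.dim (fe_space bc S T)"

(* Matrix, vector and basis indices run from 0 to N - 1. *)

definition mass_matrix ::
    "'a::euclidean_space set \<Rightarrow> nat \<Rightarrow> (nat \<Rightarrow> 'a \<Rightarrow> real) \<Rightarrow> real mat"
  where "mass_matrix S N \<phi> = mat N N (\<lambda>(j, k). l2_inner S (\<phi> j) (\<phi> k))"

definition band_part :: "nat \<Rightarrow> real mat \<Rightarrow> real mat"
  where "band_part l B = mat (dim_row B) (dim_col B)
    (\<lambda>(j, k). if \<bar>int j - int k\<bar> \<le> int l then B $$ (j, k) else 0)"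

definition lumping :: "real mat \<Rightarrow> real mat"
  where "lumping B = mat (dim_row B) (dim_col B)
    (\<lambda>(m, n). if m = n then \<Sum>k<dim_col B. B $$ (m, k) else 0)"

definition partially_lumped :: "nat \<Rightarrow> real mat \<Rightarrow> real mat"
  where "partially_lumped l M = band_part l M + lumping (M - band_part l M)"

definition coords :: "nat \<Rightarrow> (nat \<Rightarrow> 'a \<Rightarrow> real) \<Rightarrow> ('a \<Rightarrow> real) \<Rightarrow> real vec"
  where "coords N \<phi> v = (THE c. c \<in> carrier_vec N \<and> v = (\<lambda>x. \<Sum>j<N. c $ j * \<phi> j x))"

definition lumped_inner :: "'a::euclidean_space set \<Rightarrow> nat \<Rightarrow> (nat \<Rightarrow> 'a \<Rightarrow> real) \<Rightarrow> nat
      \<Rightarrow> ('a \<Rightarrow> real) \<Rightarrow> ('a \<Rightarrow> real) \<Rightarrow> real"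
  where "lumped_inner S N \<phi> l u v = scalar_prod (coords N \<phi> u)
    (partially_lumped l (mass_matrix S N \<phi>) *\<^sub>v coords N \<phi> v)"

definition inner_product_on ::
    "('a \<Rightarrow> real) set \<Rightarrow> (('a \<Rightarrow> real) \<Rightarrow> ('a \<Rightarrow> real) \<Rightarrow> real) \<Rightarrow> bool"
  where "inner_product_on V ip \<longleftrightarrow>
    (\<forall>u\<in>V. \<forall>v\<in>V. ip u v = ip v u) \<and>
    (\<forall>u\<in>V. \<forall>v\<in>V. \<forall>w\<in>V. ip (\<lambda>x. u x + v x) w = ip u w + ip v w) \<and>
    (\<forall>c. \<forall>u\<in>V. \<forall>v\<in>V. ip (\<lambda>x. c * u x) v = c * ip u v) \<and>
    (\<forall>u\<in>V. 0 \<le> ip u u \<and> (ip u u = 0 \<longleftrightarrow> u = (\<lambda>x. 0)))"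

(* Admissibility is a property of a family. The members are indexed by I, with mesh size h i; the
   index may carry more than the mesh, and the constants are uniform over all of I. *)
definition admissible_inner_products :: "'a::euclidean_space set \<Rightarrow> 'i set \<Rightarrow> ('i \<Rightarrow> real)
      \<Rightarrow> ('i \<Rightarrow> ('a \<Rightarrow> real) set) \<Rightarrow> ('i \<Rightarrow> ('a \<Rightarrow> real) \<Rightarrow> ('a \<Rightarrow> real) \<Rightarrow> real) \<Rightarrow> bool"
  where "admissible_inner_products S I h V ip \<longleftrightarrow>
    (\<forall>i\<in>I. inner_product_on (V i) (ip i)) \<and>
    (\<exists>C. \<forall>i\<in>I. \<forall>u\<in>V i. \<forall>v\<in>V i.
      \<bar>l2_inner S u v - ip i u v\<bar> \<le> C * (h i)\<^sup>2 * h1_seminorm S u * h1_seminorm S v) \<and>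
    (\<exists>C. \<forall>i\<in>I. \<forall>u\<in>V i. sqrt (ip i u u) \<le> C * l2_norm S u) \<and>
    (\<exists>C. \<forall>i\<in>I. \<forall>u\<in>V i. l2_norm S u \<le> C * sqrt (ip i u u))"

end

theory Submission
  imports Defs
begin

text \<open>
  Write \<open>u\<^sub>j = u (z\<^sub>j)\<close>. By symmetry of the mass matrix the lumping error is
  \<open>(u, v) - \<langle>u, v\<rangle>\<^sub>l = - 1/2 \<Sum> M\<^sub>j\<^sub>k (u\<^sub>j - u\<^sub>k) (v\<^sub>j - v\<^sub>k)\<close>, summed over \<open>\<bar>j - k\<bar> > l\<close>.
  The contribution of a cell \<open>K\<close> to \<open>M\<^sub>j\<^sub>k\<close> vanishes unless \<open>K\<close> contains both nodes, where
  \<open>\<bar>u\<^sub>j - u\<^sub>k\<bar> \<le> h \<bar>\<nabla>u\<bar>\<close>, and these contributions sum to at most \<open>\<bar>K\<bar>\<close>; Cauchy-Schwarz over the cells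
  gives consistency with constant \<open>1/2\<close>. For \<open>u = v\<close> the identity shows that lumping increases
  the norm. Conversely, the lumped norm is at most the sum over the cells of \<open>\<bar>K\<bar> max\<^sub>K u\<^sup>2\<close>, and on
  any convex body in dimension \<open>d\<close> an affine function satisfies
  \<open>\<bar>K\<bar> max\<^sub>K u\<^sup>2 \<le> 4\<^bsup>d + 1\<^esup> \<integral>\<^sub>K u\<^sup>2\<close>.
\<close>

section \<open>Affine functions on compact convex sets\<close>

definition affine_on :: "'a::real_inner set \<Rightarrow> ('a \<Rightarrow> real) \<Rightarrow> bool"
  where "affine_on K u \<longleftrightarrow> (\<exists>a b. \<forall>x\<in>K. u x = inner a x + b)"

lemma affine_on_const: "affine_on K (\<lambda>x. c)"
  unfolding affine_on_def by (rule exI[of _ 0], rule exI[of _ c]) simp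

lemma affine_on_add:
  assumes "affine_on K u" "affine_on K v"
  shows "affine_on K (\<lambda>x. u x + v x)"
proof -
  obtain a b a' b' where *: "\<forall>x\<in>K. u x = inner a x + b" "\<forall>x\<in>K. v x = inner a' x + b'"
    using assms unfolding affine_on_def by blast
  show ?thesis
    unfolding affine_on_def
    by (rule exI[of _ "a + a'"], rule exI[of _ "b + b'"]) (use * in \<open>auto simp: inner_add_left\<close>)
qed

lemma affine_on_cmult:
  assumes "affine_on K u"
  shows "affine_on K (\<lambda>x. c * u x)"
proof -
  obtain a b where *: "\<forall>x\<in>K. u x = inner a x + b"
    using assms unfolding affine_on_def by blast
  show ?thesis
    unfolding affine_on_def
    by (rule exI[of _ "c *\<^sub>R a"], rule exI[of _ "c * b"]) (use * in \<open>auto simp: distrib_left\<close>)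
qed

lemma affine_on_diff:
  assumes "affine_on K u" "affine_on K v"
  shows "affine_on K (\<lambda>x. u x - v x)"
  using affine_on_add[OF assms(1) affine_on_cmult[OF assms(2), of "- 1"]] by simp

lemma affine_on_sum:
  assumes "\<And>i. i \<in> I \<Longrightarrow> affine_on K (f i)"
  shows "affine_on K (\<lambda>x. \<Sum>i\<in>I. f i x)"
  using assms
  by (induction I rule: infinite_finite_induct) (simp_all add: affine_on_const affine_on_add)

lemma affine_on_continuous:
  assumes "affine_on K u"
  shows "continuous_on K u"
proof -
  obtain a b where *: "\<forall>x\<in>K. u x = inner a x + b"
    using assms unfolding affine_on_def by blast
  have "continuous_on K (\<lambda>x. inner a x + b)"
    by (intro continuous_intros)
  then show ?thesis
    using * by (metis (no_types, lifting) continuous_on_cong)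
qed

text \<open>\<open>K\<close> is the convex hull of its extreme points, and the half-space where the
  affine formula is nonnegative is convex. All comparisons of affine functions on a cell thereby
  reduce to vertex values.\<close>

lemma affine_on_nonneg:
  fixes K :: "'a::euclidean_space set"
  assumes K: "compact K" "convex K" and u: "affine_on K u"
    and ext: "\<And>z. z extreme_point_of K \<Longrightarrow> 0 \<le> u z" and x: "x \<in> K"
  shows "0 \<le> u x"
proof -
  obtain a b where ab: "\<forall>x\<in>K. u x = inner a x + b"
    using u unfolding affine_on_def by blast
  have "convex hull {z. z extreme_point_of K} \<subseteq> {y. inner a y \<ge> - b}"
  proof (rule hull_minimal)
    show "{z. z extreme_point_of K} \<subseteq> {y. inner a y \<ge> - b}"
    proof
      fix y assume "y \<in> {z. z extreme_point_of K}"
      then have y: "y extreme_point_of K" by simp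
      then have "y \<in> K" by (simp add: extreme_point_of_def)
      then show "y \<in> {y. inner a y \<ge> - b}" using ext[OF y] ab by auto
    qed
  qed (rule convex_halfspace_ge)
  moreover have "x \<in> convex hull {z. z extreme_point_of K}"
    using Krein_Milman_Minkowski[OF K] x by blast
  ultimately show ?thesis using ab x by auto
qed

lemma affine_on_mono:
  fixes K :: "'a::euclidean_space set"
  assumes "compact K" "convex K" "affine_on K u" "affine_on K v"
    and "\<And>z. z extreme_point_of K \<Longrightarrow> u z \<le> v z" "x \<in> K"
  shows "u x \<le> v x"
  using affine_on_nonneg[OF assms(1,2) affine_on_diff[OF assms(4,3)], of x] assms(5,6) by simp

lemma affine_on_eqI:
  fixes K :: "'a::euclidean_space set"
  assumes "compact K" "convex K" "affine_on K u" "affine_on K v"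
    and "\<And>z. z extreme_point_of K \<Longrightarrow> u z = v z" "x \<in> K"
  shows "u x = v x"
  using affine_on_mono[OF assms(1-4), of x] affine_on_mono[OF assms(1,2,4,3), of x] assms(5,6)
  by (simp add: order_antisym)

section \<open>Affine interpolation at the vertices of a simplex\<close>

lemma affine_independent_interpolation:
  fixes C :: "'a::euclidean_space set" and g :: "'a \<Rightarrow> real"
  assumes "\<not> affine_dependent C"
  obtains a b where "\<And>x. x \<in> C \<Longrightarrow> inner a x + b = g x"
proof (cases "C = {}")
  case True
  then show ?thesis using that by blast
next
  case False
  then obtain p where p: "p \<in> C" by blast
  \<comment> \<open>Moving \<open>p\<close> to the origin turns affine into linear independence, so
    the increments of \<open>g\<close> from \<open>p\<close> extend to a linear functional.\<close>
  have "independent ((\<lambda>x. - p + x) ` (C - {p}))"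
    using assms affine_dependent_iff_dependent2[OF p] by blast
  from real_vector.linear_independent_extend[OF this, where f = "\<lambda>y. g (p + y) - g p"]
  obtain f :: "'a \<Rightarrow> real" where f: "linear f"
    and fg: "\<forall>y\<in>(\<lambda>x. - p + x) ` (C - {p}). f y = g (p + y) - g p"
    by (auto simp: linear_def real_scaleR_def[abs_def])
  \<comment> \<open>\<open>adjoint f 1\<close> is the vector representing the functional
    \<open>f\<close>; it becomes the gradient of the interpolant.\<close>
  have inner: "inner (adjoint f 1) x = f x" for x
    using adjoint_works[OF f, of x 1] by (simp add: inner_commute)
  have "f (x - p) = g x - g p" if "x \<in> C" for x
    using that fg linear_0[OF f] by (cases "x = p") (auto simp: add.commute)
  then have "inner (adjoint f 1) x + (g p - f p) = g x" if "x \<in> C" for x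
    using that linear_diff[OF f, of x p] by (simp add: inner)
  then show ?thesis using that by blast
qed

lemma simplex_affine_interpolation:
  fixes K :: "'a::euclidean_space set" and g :: "'a \<Rightarrow> real"
  assumes "n simplex K"
  obtains a b where "\<And>z. z extreme_point_of K \<Longrightarrow> inner a z + b = g z"
proof -
  obtain C where "\<not> affine_dependent C" "K = convex hull C"
    using assms unfolding simplex_def by blast
  then show ?thesis
    using that affine_independent_interpolation[of C g]
    by (metis extreme_point_of_convex_hull_affine_independent)
qed

section \<open>Integrals over a single compact convex body\<close>

lemma set_integrable_compact_lebesgue:
  fixes f :: "'a::euclidean_space \<Rightarrow> real"
  assumes "compact K" "continuous_on K f"
  shows "set_integrable lebesgue K f"
  using borel_integrable_compact[OF assms] integrable_completion[of _ lborel]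
  unfolding set_integrable_def by (metis borel_measurable_integrable)

text \<open>With \<open>z\<close> a maximum point of \<open>\<bar>u\<bar>\<close>, one has \<open>\<bar>u\<bar> \<ge> \<bar>u z\<bar> / 2\<close> on the copy of \<open>K\<close> shrunk
  towards \<open>z\<close> by the factor \<open>1/4\<close>.\<close>

lemma affine_on_square_le_integral:
  fixes K :: "'a::euclidean_space set"
  assumes K: "compact K" "convex K" and u: "affine_on K u" and x: "x \<in> K"
  shows "(u x)\<^sup>2 * measure lebesgue K \<le> 4 ^ (DIM('a) + 1) * (LINT y:K|lebesgue. u y * u y)"
proof -
  have cont: "continuous_on K u" by (rule affine_on_continuous[OF u])
  have "continuous_on K (\<lambda>y. \<bar>u y\<bar>)" by (intro continuous_intros cont)
  then obtain z where z: "z \<in> K" and max: "\<And>y. y \<in> K \<Longrightarrow> \<bar>u y\<bar> \<le> \<bar>u z\<bar>"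
    using continuous_attains_sup[OF K(1)] x by (metis empty_iff)
  obtain a b where ab: "\<forall>x\<in>K. u x = inner a x + b"
    using u unfolding affine_on_def by blast
  define K' where "K' = (\<lambda>y. (1/4) *\<^sub>R y + (3/4) *\<^sub>R z) ` K"
  have K'K: "K' \<subseteq> K"
    unfolding K'_def using z convexD[OF K(2)] by (auto simp: add_divide_distrib[symmetric])
  have "compact K'"
    unfolding K'_def by (intro compact_continuous_image K continuous_intros)
  have low: "(u z)\<^sup>2 / 4 \<le> u w * u w" if w: "w \<in> K'" for w
  proof -
    obtain y where y: "y \<in> K" and wy: "w = (1/4) *\<^sub>R y + (3/4) *\<^sub>R z"
      using w unfolding K'_def by blast
    have "w \<in> K" using w K'K by blast
    then have "u w = (1/4) * u y + (3/4) * u z"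
      using ab y z by (simp add: wy inner_add_right field_simps)
    \<comment> \<open>The weight 3/4 at the maximum point loses at most 1/4, since
      \<open>\<bar>u y\<bar> \<le> \<bar>u z\<bar>\<close>.\<close>
    then have "\<bar>u z\<bar> / 2 \<le> \<bar>u w\<bar>"
      using max[OF y] by linarith
    then have "(\<bar>u z\<bar> / 2)\<^sup>2 \<le> \<bar>u w\<bar>\<^sup>2"
      by (intro power_mono) auto
    then show ?thesis by (simp add: power2_eq_square)
  qed
  have meas: "measure lebesgue K' = (1/4) ^ DIM('a) * measure lebesgue K"
    unfolding K'_def using measure_lebesgue_affine[of "1/4" "(3/4) *\<^sub>R z" K] by simp
  have "(u z)\<^sup>2 / 4 * measure lebesgue K' = (LINT y:K'|lebesgue. (u z)\<^sup>2 / 4)"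
    unfolding set_lebesgue_integral_def using lmeasurable_compact[OF \<open>compact K'\<close>]
    by (simp add: fmeasurable_def)
  also have "\<dots> \<le> (LINT y:K|lebesgue. u y * u y)"
    unfolding set_lebesgue_integral_def
  proof (rule integral_mono)
    show "integrable lebesgue (\<lambda>y. indicator K' y *\<^sub>R ((u z)\<^sup>2 / 4))"
      using set_integrable_compact_lebesgue[OF \<open>compact K'\<close>, of "\<lambda>y. (u z)\<^sup>2 / 4"]
      unfolding set_integrable_def by simp
    show "integrable lebesgue (\<lambda>y. indicator K y *\<^sub>R (u y * u y))"
      using set_integrable_compact_lebesgue[OF K(1), of "\<lambda>y. u y * u y"] cont
      unfolding set_integrable_def by (simp add: continuous_on_mult)
    show "indicator K' y *\<^sub>R ((u z)\<^sup>2 / 4) \<le> indicator K y *\<^sub>R (u y * u y)" for y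
      using K'K low[of y] by (auto simp: indicator_def)
  qed
  \<comment> \<open>The factor \<open>4 ^ DIM('a)\<close> undoes the volume ratio of
    \<open>K'\<close> to \<open>K\<close>; the extra 4 is the square of the lost factor 2.\<close>
  finally have "(u z)\<^sup>2 * measure lebesgue K \<le> 4 ^ (DIM('a) + 1) * (LINT y:K|lebesgue. u y * u y)"
    unfolding meas by (simp add: power_one_over field_simps)
  moreover have "(u x)\<^sup>2 \<le> (u z)\<^sup>2"
    using max[OF x] by (simp add: abs_le_square_iff)
  ultimately show ?thesis
    by (meson measure_nonneg mult_right_mono order_trans)
qed

section \<open>Continuous piecewise affine functions on a mesh\<close>

text \<open>Each formula holds on a whole closed cell, so formulas agree where cells meet and
  continuity on a mesh follows. The value 0 elsewhere makes equality of total functions the same as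
  equality on the union of the cells.\<close>

definition pw_affine :: "'a::real_inner set set \<Rightarrow> ('a \<Rightarrow> real) \<Rightarrow> bool"
  where "pw_affine T u \<longleftrightarrow> (\<forall>K\<in>T. affine_on K u) \<and> (\<forall>x. x \<notin> \<Union>T \<longrightarrow> u x = 0)"

locale mesh_domain =
  fixes S :: "'a::euclidean_space set" and T :: "'a set set"
  assumes open_S: "open S" and convex_S: "convex S" and mesh: "conforming_mesh S T"
begin

section \<open>Geometry of the cells\<close>

lemma finite_mesh: "finite T"
  and cell_simplex: "K \<in> T \<Longrightarrow> int DIM('a) simplex K"
  and cell_Int_face: "K \<in> T \<Longrightarrow> K' \<in> T \<Longrightarrow> K \<inter> K' face_of K"
  and Union_mesh: "\<Union>T = closure S"
  using mesh unfolding conforming_mesh_def triangulation_def by auto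

lemma cell_compact: "K \<in> T \<Longrightarrow> compact K"
  and cell_convex: "K \<in> T \<Longrightarrow> convex K"
  using cell_simplex compact_simplex convex_simplex by blast+

lemma interior_cell_nonempty:
  assumes "K \<in> T" shows "interior K \<noteq> {}"
proof -
  have "aff_dim K = int DIM('a)" using aff_dim_simplex[OF cell_simplex[OF assms]] .
  then have "interior K = rel_interior K"
    by (simp add: interior_rel_interior_gen)
  moreover have "K \<noteq> {}" using \<open>aff_dim K = int DIM('a)\<close> aff_dim_empty[of K] by auto
  ultimately show ?thesis
    using rel_interior_eq_empty[OF cell_convex[OF assms]] by simp
qed

lemma cell_measure_pos:
  assumes "K \<in> T" shows "0 < measure lebesgue K"
proof -
  have "measure lebesgue K \<noteq> 0"
  proof
    assume "measure lebesgue K = 0"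
    then have "negligible K"
      using lmeasurable_compact[OF cell_compact[OF assms]] negligible_iff_measure by blast
    then show False
      using interior_cell_nonempty[OF assms] negligible_subset open_not_negligible
      by (metis interior_subset open_interior)
  qed
  then show ?thesis by (simp add: measure_nonneg zero_less_measure_iff)
qed

text \<open>The intersection is a face of both cells, and a proper face misses the interior.\<close>

lemma interior_cells_unique:
  assumes "K \<in> T" "K' \<in> T" "x \<in> interior K" "x \<in> interior K'"
  shows "K = K'"
proof -
  have "x \<in> K \<inter> K'" using assms interior_subset by blast
  then have "K \<inter> K' = K" "K' \<inter> K = K'"
    using face_of_disjoint_interior[OF cell_Int_face] assms by blast+
  then show ?thesis by blast
qed

section \<open>Piecewise affine functions and their vertex values\<close>

lemma vertex_in_mesh_vertices: "K \<in> T \<Longrightarrow> v extreme_point_of K \<Longrightarrow> v \<in> mesh_vertices T"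
  unfolding mesh_vertices_def by blast

lemma pw_affine_eqI:
  assumes u: "pw_affine T u" and v: "pw_affine T v"
    and eq: "\<And>x. x \<in> mesh_vertices T \<Longrightarrow> u x = v x"
  shows "u = v"
proof
  fix x
  show "u x = v x"
  proof (cases "x \<in> \<Union>T")
    case True
    then obtain K where K: "K \<in> T" "x \<in> K" by blast
    show ?thesis
    proof (rule affine_on_eqI[OF cell_compact[OF K(1)] cell_convex[OF K(1)] _ _ _ K(2)])
      show "affine_on K u" "affine_on K v" using u v K unfolding pw_affine_def by auto
    qed (use eq vertex_in_mesh_vertices K in blast)
  qed (use u v in \<open>auto simp: pw_affine_def\<close>)
qed

lemma pw_affine_continuous_on:
  assumes "pw_affine T u"
  shows "continuous_on (\<Union>T) u"
proof -
  have "continuous_on (\<Union>K\<in>T. K) u"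
  proof (rule continuous_on_closed_Union[OF finite_mesh])
    show "closed K" if "K \<in> T" for K using that cell_compact compact_imp_closed by blast
    show "continuous_on K u" if "K \<in> T" for K
      using that assms affine_on_continuous unfolding pw_affine_def by blast
  qed
  then show ?thesis by simp
qed

text \<open>Interpolate on each simplex separately. Two cells meet in a common face, whose extreme
  points are vertices of both cells; there both formulas equal \<open>g\<close>, hence they agree on
  the whole face.\<close>

lemma pw_affine_interpolation:
  obtains u where "pw_affine T u" "\<And>x. x \<in> mesh_vertices T \<Longrightarrow> u x = g x"
proof -
  have "\<exists>a b. \<forall>v. v extreme_point_of K \<longrightarrow> inner a v + b = g v" if "K \<in> T" for K
    using simplex_affine_interpolation[OF cell_simplex[OF that]] by metis
  then obtain a b where ab: "\<And>K v. K \<in> T \<Longrightarrow> v extreme_point_of K \<Longrightarrow> inner (a K) v + b K = g v"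
    by metis
  have agree: "inner (a K) x + b K = inner (a K') x + b K'"
    if K: "K \<in> T" "K' \<in> T" and x: "x \<in> K" "x \<in> K'" for K K' x
  proof (rule affine_on_eqI[of "K \<inter> K'" "\<lambda>x. inner (a K) x + b K" "\<lambda>x. inner (a K') x + b K'"])
    show "compact (K \<inter> K')" "convex (K \<inter> K')"
      using K cell_compact cell_convex by (auto intro: compact_Int convex_Int)
    fix v assume v: "v extreme_point_of (K \<inter> K')"
    then have "v extreme_point_of K" "v extreme_point_of K'"
      using extreme_point_of_face[OF cell_Int_face] K by (metis Int_commute)+
    then show "inner (a K) v + b K = inner (a K') v + b K'" using ab K by simp
  qed (use x in \<open>auto simp: affine_on_def\<close>)
  \<comment> \<open>An arbitrary cell through \<open>x\<close>; \<open>agree\<close> makes the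
    choice immaterial.\<close>
  define cell where "cell x = (SOME K. K \<in> T \<and> x \<in> K)" for x
  have cell: "cell x \<in> T" "x \<in> cell x" if "x \<in> \<Union>T" for x
    using that someI_ex[of "\<lambda>K. K \<in> T \<and> x \<in> K"] unfolding cell_def by blast+
  define u where "u x = (if x \<in> \<Union>T then inner (a (cell x)) x + b (cell x) else 0)" for x
  have u: "u x = inner (a K) x + b K" if "K \<in> T" "x \<in> K" for K x
    using that cell[of x] agree[of "cell x" K x] unfolding u_def by auto
  show ?thesis
  proof
    have "affine_on K u" if "K \<in> T" for K
      unfolding affine_on_def using u[OF that] by blast
    then show "pw_affine T u" unfolding pw_affine_def by (simp add: u_def)
    show "u x = g x" if "x \<in> mesh_vertices T" for x
    proof -
      obtain K where K: "K \<in> T" "x extreme_point_of K"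
        using \<open>x \<in> mesh_vertices T\<close> unfolding mesh_vertices_def by blast
      then have "x \<in> K" by (simp add: extreme_point_of_def)
      then show ?thesis using u K ab by simp
    qed
  qed
qed

section \<open>Nodal functions\<close>

lemma nodal_function_properties:
  shows nodal_pw_affine: "pw_affine T (nodal_function T p)"
    and nodal_at_vertex: "q \<in> mesh_vertices T \<Longrightarrow> nodal_function T p q = (if q = p then 1 else 0)"
proof -
  \<comment> \<open>\<open>P\<close> repeats the body of the description in
    \<open>nodal_function\<close>, so that \<open>theI\<close> applies. Existence comes from
    interpolation, uniqueness from the vertex values.\<close>
  define P where "P \<phi> \<longleftrightarrow> continuous_on (\<Union>T) \<phi> \<and>
     (\<forall>K\<in>T. \<exists>a b. \<forall>x\<in>K. \<phi> x = inner a x + b) \<and>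
     (\<forall>z'\<in>mesh_vertices T. \<phi> z' = (if z' = p then 1 else 0)) \<and>
     (\<forall>x. x \<notin> \<Union>T \<longrightarrow> \<phi> x = 0)" for \<phi> :: "'a \<Rightarrow> real"
  have P_iff: "P \<phi> \<longleftrightarrow> pw_affine T \<phi> \<and> (\<forall>q\<in>mesh_vertices T. \<phi> q = (if q = p then 1 else 0))" for \<phi>
    using pw_affine_continuous_on[of \<phi>] unfolding P_def pw_affine_def affine_on_def by blast
  obtain u where "pw_affine T u" "\<And>x. x \<in> mesh_vertices T \<Longrightarrow> u x = (if x = p then 1 else 0)"
    using pw_affine_interpolation[of "\<lambda>x. if x = p then 1 else 0"] by blast
  then have "P u" unfolding P_iff by blast
  moreover have "\<phi> = u" if "P \<phi>" for \<phi>
    using that \<open>P u\<close> unfolding P_iff by (intro pw_affine_eqI) auto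
  ultimately have "P (nodal_function T p)"
    unfolding nodal_function_def P_def[symmetric] by (rule theI)
  then show "pw_affine T (nodal_function T p)"
    and "q \<in> mesh_vertices T \<Longrightarrow> nodal_function T p q = (if q = p then 1 else 0)"
    unfolding P_iff by blast+
qed

lemma nodal_affine_on: "K \<in> T \<Longrightarrow> affine_on K (nodal_function T p)"
  using nodal_pw_affine unfolding pw_affine_def by blast

lemma nodal_nonneg:
  assumes "K \<in> T" "x \<in> K" shows "0 \<le> nodal_function T p x"
  using affine_on_nonneg[OF cell_compact cell_convex nodal_affine_on] assms
  by (simp add: nodal_at_vertex vertex_in_mesh_vertices)

text \<open>Only at \<open>p\<close> can a vertex value be nonzero, so every extreme point of such a
  cell carries the value 0.\<close>

lemma nodal_zero_off_patch:
  assumes K: "K \<in> T" "x \<in> K" and p: "p \<notin> K"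
  shows "nodal_function T p x = 0"
proof (rule affine_on_eqI[OF cell_compact[OF K(1)] cell_convex[OF K(1)]
      nodal_affine_on[OF K(1)] affine_on_const _ K(2)])
  fix v assume v: "v extreme_point_of K"
  then have "v \<noteq> p" using p by (auto simp: extreme_point_of_def)
  then show "nodal_function T p v = 0"
    using nodal_at_vertex vertex_in_mesh_vertices K v by simp
qed

section \<open>Integration cell by cell\<close>

text \<open>Almost every point of \<open>S\<close> is interior to exactly one cell. Matching
  \<open>f\<close> with \<open>g K\<close> only inside the cells admits gradients, which jump across
  faces.\<close>

lemma pw_affine_set_integral:
  fixes f :: "'a \<Rightarrow> real"
  assumes g: "\<And>K. K \<in> T \<Longrightarrow> continuous_on K (g K)"
    and f: "\<And>K x. K \<in> T \<Longrightarrow> x \<in> interior K \<Longrightarrow> f x = g K x"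
  shows mesh_set_integrable: "set_integrable lebesgue S f"
    and mesh_set_integral: "(LINT x:S|lebesgue. f x) = (\<Sum>K\<in>T. LINT x:K|lebesgue. g K x)"
proof -
  define G where "G x = (\<Sum>K\<in>T. indicator K x *\<^sub>R g K x)" for x
  have int: "integrable lebesgue (\<lambda>x. indicator K x *\<^sub>R g K x)" if "K \<in> T" for K
    using set_integrable_compact_lebesgue[OF cell_compact g] that unfolding set_integrable_def by blast
  then have intG: "integrable lebesgue G"
    unfolding G_def by (intro Bochner_Integration.integrable_sum)
  \<comment> \<open>Frontiers of convex sets are null. Off \<open>Z\<close>, a point of a cell is
    interior to it, and a point outside \<open>S\<close> is outside the closure too.\<close>
  define Z where "Z = frontier S \<union> (\<Union>K\<in>T. frontier K)"
  have "negligible Z"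
    unfolding Z_def using finite_mesh
    by (auto intro!: negligible_Un negligible_Union negligible_convex_frontier convex_S cell_convex)
  then have Z: "Z \<in> null_sets lebesgue" using negligible_iff_null_sets by blast
  have eq: "indicator S x *\<^sub>R f x = G x" if "x \<notin> Z" for x
  proof (cases "x \<in> S")
    case True
    then obtain K where K: "K \<in> T" "x \<in> K" using Union_mesh closure_subset by blast
    have inner: "x \<in> interior K'" if "K' \<in> T" "x \<in> K'" for K'
      using that \<open>x \<notin> Z\<close> closure_subset unfolding Z_def frontier_def by blast
    have "x \<notin> K'" if "K' \<in> T - {K}" for K'
      using that inner interior_cells_unique K by blast
    then have "G x = (\<Sum>K'\<in>{K}. indicator K' x *\<^sub>R g K' x)"
      unfolding G_def using K finite_mesh by (intro sum.mono_neutral_right) auto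
    then show ?thesis using K True f[OF K(1) inner[OF K]] by simp
  next
    case False
    then have "x \<notin> closure S"
      using that open_S interior_open unfolding Z_def frontier_def by blast
    then have "x \<notin> K" if "K \<in> T" for K using Union_mesh that by blast
    then show ?thesis using False unfolding G_def by simp
  qed
  have AE: "AE x in lebesgue. G x = indicator S x *\<^sub>R f x"
    by (rule AE_I'[OF Z]) (use eq in force)
  \<comment> \<open>Measurability passes from \<open>G\<close> to the restriction of
    \<open>f\<close> by equality almost everywhere, because Lebesgue measure is complete.\<close>
  have meas: "(\<lambda>x. indicator S x *\<^sub>R f x) \<in> borel_measurable lebesgue"
    by (rule borel_measurable_AE[OF borel_measurable_integrable[OF intG] AE])
  show "set_integrable lebesgue S f"
    unfolding set_integrable_def using integrable_cong_AE[OF _ meas AE] intG by blast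
  have "(LINT x:S|lebesgue. f x) = integral\<^sup>L lebesgue G"
    unfolding set_lebesgue_integral_def
    using integral_cong_AE[OF _ meas AE] intG by (metis borel_measurable_integrable)
  also have "\<dots> = (\<Sum>K\<in>T. LINT x:K|lebesgue. g K x)"
    unfolding G_def set_lebesgue_integral_def using int by (rule Bochner_Integration.integral_sum)
  finally show "(LINT x:S|lebesgue. f x) = (\<Sum>K\<in>T. LINT x:K|lebesgue. g K x)" .
qed

lemma pw_affine_mult_integrable:
  assumes "pw_affine T u" "pw_affine T v"
  shows "set_integrable lebesgue S (\<lambda>x. u x * v x)"
  by (rule mesh_set_integrable[of "\<lambda>K x. u x * v x"])
    (use assms affine_on_continuous in \<open>auto simp: pw_affine_def intro!: continuous_on_mult\<close>)

lemma l2_inner_cells: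
  assumes "pw_affine T u" "pw_affine T v"
  shows "l2_inner S u v = (\<Sum>K\<in>T. LINT x:K|lebesgue. u x * v x)"
  unfolding l2_inner_def
  by (rule mesh_set_integral)
    (use assms affine_on_continuous in \<open>auto simp: pw_affine_def intro!: continuous_on_mult\<close>)

text \<open>The gradient is the constant \<open>a K\<close> inside each cell. The form as an
  \<open>L2_set\<close> prepares the Cauchy-Schwarz inequality over the cells.\<close>

lemma h1_seminorm_cells:
  assumes a: "\<And>K x. K \<in> T \<Longrightarrow> x \<in> K \<Longrightarrow> u x = inner (a K) x + b K"
  shows "h1_seminorm S u = L2_set (\<lambda>K. sqrt (measure lebesgue K) * norm (a K)) T"
proof -
  have grad: "grad u x = a K" if K: "K \<in> T" "x \<in> interior K" for K x
  proof -
    have "((\<lambda>x. inner (a K) x + b K) has_derivative (\<lambda>h. inner h (a K))) (at x)"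
      by (auto intro!: derivative_eq_intros simp: inner_commute)
    then have "(u has_derivative (\<lambda>h. inner h (a K))) (at x)"
      by (rule has_derivative_transform_within_open[OF _ open_interior K(2)])
        (use a[OF K(1)] interior_subset[of K] in \<open>auto simp: subset_iff\<close>)
    then have D: "GDERIV u x :> a K" by (simp add: gderiv_def)
    \<comment> \<open>\<open>grad\<close> is a definite description, so the gradient vector must
      also be shown unique.\<close>
    moreover have "g = a K" if "GDERIV u x :> g" for g
    proof -
      have "(\<lambda>h. inner h g) = (\<lambda>h. inner h (a K))"
        using that D unfolding gderiv_def by (rule has_derivative_unique)
      then have "inner h (g - a K) = 0" for h by (metis inner_diff_right right_minus_eq)
      then show ?thesis by (metis inner_eq_zero_iff right_minus_eq)
    qed
    ultimately show ?thesis unfolding grad_def by (rule the_equality)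
  qed
  have "(LINT x:S|lebesgue. (norm (grad u x))\<^sup>2) = (\<Sum>K\<in>T. LINT x:K|lebesgue. (norm (a K))\<^sup>2)"
    by (rule mesh_set_integral) (simp_all add: grad)
  also have "\<dots> = (\<Sum>K\<in>T. (sqrt (measure lebesgue K) * norm (a K))\<^sup>2)"
  proof (rule sum.cong)
    fix K assume "K \<in> T"
    then show "(LINT x:K|lebesgue. (norm (a K))\<^sup>2) = (sqrt (measure lebesgue K) * norm (a K))\<^sup>2"
      using lmeasurable_compact[OF cell_compact]
      unfolding set_lebesgue_integral_def
      by (simp add: fmeasurable_def power_mult_distrib measure_nonneg)
  qed simp
  finally show ?thesis unfolding h1_seminorm_def L2_set_def by simp
qed

lemma dist_le_mesh_size:
  assumes "K \<in> T" "x \<in> K" "y \<in> K"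
  shows "norm (x - y) \<le> mesh_size T"
proof -
  have "dist x y \<le> diameter K"
    using assms cell_compact compact_imp_bounded diameter_bounded_bound by blast
  also have "\<dots> \<le> mesh_size T"
    unfolding mesh_size_def using finite_mesh assms by (intro Max_ge) auto
  finally show ?thesis by (simp add: dist_norm)
qed

text \<open>Every cell integral is then at most 0, and \<open>affine_on_square_le_integral\<close>
  on a cell of positive measure forces \<open>u x = 0\<close>. This supplies definiteness.\<close>

lemma pw_affine_l2_zero:
  assumes u: "pw_affine T u" and 0: "l2_inner S u u \<le> 0"
  shows "u = (\<lambda>x. 0)"
proof
  fix x
  show "u x = 0"
  proof (cases "x \<in> \<Union>T")
    case True
    then obtain K where K: "K \<in> T" "x \<in> K" by blast
    have "(LINT x:K|lebesgue. u x * u x) \<le> l2_inner S u u"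
      unfolding l2_inner_cells[OF u u] using K(1) finite_mesh
      by (intro member_le_sum) (auto simp: set_lebesgue_integral_def)
    then have "(u x)\<^sup>2 * measure lebesgue K \<le> 4 ^ (DIM('a) + 1) * 0"
      using affine_on_square_le_integral[OF cell_compact cell_convex _ K(2), of u] K(1) u 0
      unfolding pw_affine_def
      by (meson order_trans mult_left_mono zero_le_numeral zero_le_power)
    then show ?thesis
      using cell_measure_pos[OF K(1)] by (simp add: mult_le_0_iff)
  qed (use u in \<open>auto simp: pw_affine_def\<close>)
qed

end

section \<open>The finite element space and its partially lumped mass matrix\<close>

lemma integral_double_sum:
  fixes f :: "'i \<Rightarrow> 'j \<Rightarrow> 'a \<Rightarrow> real"
  assumes "\<And>i j. integrable M (f i j)"
  shows "(\<integral>x. (\<Sum>i\<in>I. \<Sum>j\<in>J. f i j x) \<partial>M) = (\<Sum>i\<in>I. \<Sum>j\<in>J. \<integral>x. f i j x \<partial>M)"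
  using assms by (simp add: Bochner_Integration.integral_sum)

text \<open>Swap the indices and average: \<open>c j * (d k - d j) + c k * (d j - d k)\<close>
  equals \<open>- ((c j - c k) * (d j - d k))\<close>.\<close>

lemma sum_symmetric_weights:
  fixes A :: "'i \<Rightarrow> 'i \<Rightarrow> real"
  assumes "\<And>j k. A j k = A k j"
  shows "(\<Sum>j\<in>I. \<Sum>k\<in>I. A j k * (c j * (d k - d j))) =
    - (1/2) * (\<Sum>j\<in>I. \<Sum>k\<in>I. A j k * ((c j - c k) * (d j - d k)))"
proof -
  define X where "X = (\<Sum>j\<in>I. \<Sum>k\<in>I. A j k * (c j * (d k - d j)))"
  have "X = (\<Sum>j\<in>I. \<Sum>k\<in>I. A j k * (c k * (d j - d k)))"
    unfolding X_def by (subst sum.swap) (simp add: assms)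
  then have "X + X = (\<Sum>j\<in>I. \<Sum>k\<in>I. A j k * (c j * (d k - d j)) + A j k * (c k * (d j - d k)))"
    by (simp add: X_def sum.distrib)
  also have "\<dots> = (\<Sum>j\<in>I. \<Sum>k\<in>I. - (A j k * ((c j - c k) * (d j - d k))))"
    by (intro sum.cong refl) (simp add: algebra_simps)
  finally show ?thesis unfolding X_def[symmetric] by (simp add: sum_negf)
qed

locale nodal_basis = mesh_domain S T
  for S :: "'a::euclidean_space set" and T :: "'a set set" +
  fixes bc :: boundary_condition and N :: nat and z :: "nat \<Rightarrow> 'a"
  assumes enum: "bij_betw z {..<N} (active_vertices bc S T)"
begin

abbreviation \<phi> :: "nat \<Rightarrow> 'a \<Rightarrow> real"
  where "\<phi> j \<equiv> nodal_function T (z j)"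

abbreviation V :: "('a \<Rightarrow> real) set"
  where "V \<equiv> fe_space bc S T"

abbreviation mass :: "nat \<Rightarrow> nat \<Rightarrow> real"
  where "mass j k \<equiv> l2_inner S (\<phi> j) (\<phi> k)"

lemma active_subset: "active_vertices bc S T \<subseteq> mesh_vertices T"
  by (cases bc) auto

lemma node_vertex: "j < N \<Longrightarrow> z j \<in> mesh_vertices T"
  using enum active_subset unfolding bij_betw_def by auto

lemma nodal_at_node: "j < N \<Longrightarrow> k < N \<Longrightarrow> \<phi> j (z k) = (if j = k then 1 else 0)"
  using nodal_at_vertex[OF node_vertex] enum unfolding bij_betw_def inj_on_def by auto

lemma sum_nodal_at_node: "k < N \<Longrightarrow> (\<Sum>j<N. c j * \<phi> j (z k)) = c k"
proof -
  assume "k < N"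
  then have "(\<Sum>j<N. c j * \<phi> j (z k)) = (\<Sum>j<N. if j = k then c j else 0)"
    by (intro sum.cong) (auto simp: nodal_at_node)
  then show ?thesis using \<open>k < N\<close> by simp
qed

section \<open>The finite element space in terms of nodal values\<close>

lemma fe_space_closed:
  shows fe_space_add: "u \<in> V \<Longrightarrow> v \<in> V \<Longrightarrow> (\<lambda>x. u x + v x) \<in> V"
    and fe_space_cmult: "u \<in> V \<Longrightarrow> (\<lambda>x. c * u x) \<in> V"
  using fun_space.span_add[of u _ v] fun_space.span_scale[of u _ c]
  unfolding fe_space_def by (auto simp: plus_fun_def)

text \<open>The two properties together cut out a subspace containing all active nodal functions,
  hence their span. The second one encodes the Dirichlet condition and is vacuous for
  Neumann.\<close>

lemma fe_space_properties:
  assumes "u \<in> V"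
  shows fe_space_pw_affine: "pw_affine T u"
    and fe_space_inactive:
      "\<And>q. q \<in> mesh_vertices T \<Longrightarrow> q \<notin> active_vertices bc S T \<Longrightarrow> u q = 0"
proof -
  define W where
    "W = {u. pw_affine T u \<and> (\<forall>q\<in>mesh_vertices T - active_vertices bc S T. u q = 0)}"
  have "fun_space.subspace W"
    unfolding fun_space.subspace_def W_def pw_affine_def
    by (auto simp: affine_on_add affine_on_cmult affine_on_const plus_fun_def zero_fun_def)
  moreover have "nodal_function T ` active_vertices bc S T \<subseteq> W"
    unfolding W_def using nodal_pw_affine nodal_at_vertex by auto
  ultimately have "u \<in> W"
    using assms fun_space.span_minimal unfolding fe_space_def by blast
  then show "pw_affine T u"
    and "\<And>q. q \<in> mesh_vertices T \<Longrightarrow> q \<notin> active_vertices bc S T \<Longrightarrow> u q = 0"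
    unfolding W_def by blast+
qed

text \<open>Both sides are piecewise affine, so vertices suffice; at an inactive vertex both
  vanish.\<close>

lemma fe_space_expand:
  assumes "u \<in> V"
  shows "u = (\<lambda>x. \<Sum>j<N. u (z j) * \<phi> j x)"
proof (rule pw_affine_eqI[OF fe_space_pw_affine[OF assms]])
  show "pw_affine T (\<lambda>x. \<Sum>j<N. u (z j) * \<phi> j x)"
    unfolding pw_affine_def
    using nodal_pw_affine by (auto intro!: affine_on_sum affine_on_cmult simp: pw_affine_def)
  fix q assume q: "q \<in> mesh_vertices T"
  show "u q = (\<Sum>j<N. u (z j) * \<phi> j q)"
  proof (cases "q \<in> active_vertices bc S T")
    case True
    then obtain k where "k < N" "q = z k" using enum unfolding bij_betw_def by auto
    then show ?thesis using sum_nodal_at_node[of k "\<lambda>j. u (z j)"] by simp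
  next
    case False
    then have "q \<noteq> z j" if "j < N" for j
      using that enum unfolding bij_betw_def by auto
    then have "\<phi> j q = 0" if "j < N" for j using nodal_at_vertex[OF q] that by simp
    then show ?thesis using fe_space_inactive[OF assms q False] by simp
  qed
qed

lemma coords_eq:
  assumes "u \<in> V"
  shows "coords N \<phi> u = vec N (\<lambda>j. u (z j))"
  unfolding coords_def
proof (rule the_equality)
  show "vec N (\<lambda>j. u (z j)) \<in> carrier_vec N \<and>
      u = (\<lambda>x. \<Sum>j<N. vec N (\<lambda>j. u (z j)) $ j * \<phi> j x)"
    using fe_space_expand[OF assms] by simp
  \<comment> \<open>Evaluation at the nodes recovers any coefficient vector, which gives
    uniqueness.\<close>
  fix c assume c: "c \<in> carrier_vec N \<and> u = (\<lambda>x. \<Sum>j<N. c $ j * \<phi> j x)"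
  then have "u (z k) = (\<Sum>j<N. c $ j * \<phi> j (z k))" for k by metis
  then have "u (z k) = c $ k" if "k < N" for k
    using sum_nodal_at_node[OF that] by simp
  then show "c = vec N (\<lambda>j. u (z j))" using c by auto
qed

section \<open>The exact and the lumped form as double sums\<close>

lemma mass_commute: "mass j k = mass k j"
  unfolding l2_inner_def by (simp add: mult.commute)

lemma l2_inner_expand:
  assumes "u \<in> V" "v \<in> V"
  shows "l2_inner S u v = (\<Sum>j<N. \<Sum>k<N. mass j k * (u (z j) * v (z k)))"
proof -
  have int: "set_integrable lebesgue S (\<lambda>x. \<phi> j x * \<phi> k x)" for j k
    by (intro pw_affine_mult_integrable nodal_pw_affine)
  have "indicator S x *\<^sub>R (u x * v x) =
      (\<Sum>j<N. \<Sum>k<N. (indicator S x *\<^sub>R (\<phi> j x * \<phi> k x)) * (u (z j) * v (z k)))" for x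
  proof -
    have "u x * v x = (\<Sum>j<N. u (z j) * \<phi> j x) * (\<Sum>k<N. v (z k) * \<phi> k x)"
      using fe_space_expand[OF assms(1)] fe_space_expand[OF assms(2)] by metis
    also have "\<dots> = (\<Sum>j<N. \<Sum>k<N. (\<phi> j x * \<phi> k x) * (u (z j) * v (z k)))"
      unfolding sum_product by (intro sum.cong refl) (simp add: mult_ac)
    finally show ?thesis by (cases "x \<in> S") simp_all
  qed
  then have "l2_inner S u v = (\<integral>x. (\<Sum>j<N. \<Sum>k<N.
      (indicator S x *\<^sub>R (\<phi> j x * \<phi> k x)) * (u (z j) * v (z k))) \<partial>lebesgue)"
    unfolding l2_inner_def set_lebesgue_integral_def by (simp only:)
  also have "\<dots> = (\<Sum>j<N. \<Sum>k<N. mass j k * (u (z j) * v (z k)))"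
    unfolding l2_inner_def set_lebesgue_integral_def using int
    by (subst integral_double_sum) (simp_all add: set_integrable_def)
  finally show ?thesis .
qed

text \<open>Lumping moves an entry outside the band to the diagonal of its row, which amounts to
  replacing \<open>v (z k)\<close> by \<open>v (z j)\<close> in that term.\<close>

lemma lumped_inner_expand:
  assumes "u \<in> V" "v \<in> V"
  shows "lumped_inner S N \<phi> l u v = (\<Sum>j<N. \<Sum>k<N.
    mass j k * (u (z j) * (if \<bar>int j - int k\<bar> \<le> int l then v (z k) else v (z j))))"
proof -
  define B where "B j k = (if \<bar>int j - int k\<bar> \<le> int l then mass j k else 0)" for j k
  have entry: "partially_lumped l (mass_matrix S N \<phi>) $$ (j, k) =
      B j k + (if j = k then \<Sum>i<N. mass j i - B j i else 0)" if "j < N" "k < N" for j k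
    using that
    by (auto simp: partially_lumped_def band_part_def lumping_def mass_matrix_def B_def
        intro!: sum.cong)
  have dim: "dim_row (partially_lumped l (mass_matrix S N \<phi>)) = N"
    "dim_col (partially_lumped l (mass_matrix S N \<phi>)) = N"
    by (simp_all add: partially_lumped_def lumping_def band_part_def mass_matrix_def)
  have "lumped_inner S N \<phi> l u v = (\<Sum>j<N. u (z j) *
      (\<Sum>k<N. (B j k + (if j = k then \<Sum>i<N. mass j i - B j i else 0)) * v (z k)))"
    unfolding lumped_inner_def coords_eq[OF assms(1)] coords_eq[OF assms(2)]
    by (simp add: scalar_prod_def dim entry atLeast0LessThan[symmetric])
  \<comment> \<open>The diagonal term is spread back over the row sum defining it, to join the band
    term under one sum over \<open>k\<close>.\<close>
  also have "\<dots> = (\<Sum>j<N. \<Sum>k<N. u (z j) * (B j k * v (z k) + (mass j k - B j k) * v (z j)))"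
  proof (rule sum.cong[OF refl])
    fix j assume j: "j \<in> {..<N}"
    have "(\<Sum>k<N. (if j = k then \<Sum>i<N. mass j i - B j i else 0) * v (z k)) =
        (\<Sum>k<N. if j = k then (\<Sum>i<N. mass j i - B j i) * v (z k) else 0)"
      by (intro sum.cong) auto
    also have "\<dots> = (\<Sum>i<N. mass j i - B j i) * v (z j)" using j by simp
    finally show "u (z j) * (\<Sum>k<N. (B j k + (if j = k then \<Sum>i<N. mass j i - B j i else 0)) * v (z k)) =
        (\<Sum>k<N. u (z j) * (B j k * v (z k) + (mass j k - B j k) * v (z j)))"
      by (simp add: distrib_right sum.distrib sum_distrib_right sum_distrib_left[symmetric])
  qed
  also have "\<dots> = (\<Sum>j<N. \<Sum>k<N.
      mass j k * (u (z j) * (if \<bar>int j - int k\<bar> \<le> int l then v (z k) else v (z j))))"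
    by (intro sum.cong refl) (auto simp: B_def)
  finally show ?thesis .
qed

text \<open>The forms differ only outside the band, by the terms
  \<open>mass j k * (u (z j) * (v (z k) - v (z j)))\<close>. Weights and band being symmetric,
  \<open>sum_symmetric_weights\<close> turns these into products of increments.\<close>

lemma l2_inner_minus_lumped:
  assumes "u \<in> V" "v \<in> V"
  shows "l2_inner S u v - lumped_inner S N \<phi> l u v = - (1/2) * (\<Sum>j<N. \<Sum>k<N. mass j k *
    (if \<bar>int j - int k\<bar> \<le> int l then 0 else (u (z j) - u (z k)) * (v (z j) - v (z k))))"
proof -
  define A where "A j k = (if \<bar>int j - int k\<bar> \<le> int l then 0 else mass j k)" for j k
  have "A j k = A k j" for j k
    unfolding A_def by (simp add: mass_commute[of j k] abs_minus_commute)
  note sym = sum_symmetric_weights[OF this,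
      where I = "{..<N}" and c = "\<lambda>j. u (z j)" and d = "\<lambda>j. v (z j)"]
  have "l2_inner S u v - lumped_inner S N \<phi> l u v =
      (\<Sum>j<N. \<Sum>k<N. A j k * (u (z j) * (v (z k) - v (z j))))"
    unfolding l2_inner_expand[OF assms] lumped_inner_expand[OF assms] sum_subtractf[symmetric]
    by (intro sum.cong refl) (auto simp: A_def algebra_simps)
  \<comment> \<open>The band condition moves from the weight to the increments, leaving the full
    weight \<open>mass j k\<close> that \<open>mass_weighted_sum_le\<close> expects.\<close>
  also have "\<dots> = - (1/2) * (\<Sum>j<N. \<Sum>k<N. mass j k *
      (if \<bar>int j - int k\<bar> \<le> int l then 0 else (u (z j) - u (z k)) * (v (z j) - v (z k))))"
    unfolding sym by (intro arg_cong[of _ _ "\<lambda>x. - (1/2) * x"] sum.cong refl) (auto simp: A_def)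
  finally show ?thesis .
qed

section \<open>Cellwise bounds for sums weighted by the mass matrix\<close>

text \<open>At a vertex the sum is 1 or 0 according to whether the vertex is active, by injectivity
  of \<open>z\<close>. Inactive Dirichlet vertices are why this is only an inequality.\<close>

lemma sum_nodal_le_1:
  assumes K: "K \<in> T" "x \<in> K"
  shows "(\<Sum>j<N. \<phi> j x) \<le> 1"
proof (rule affine_on_mono[OF cell_compact[OF K(1)] cell_convex[OF K(1)] _ affine_on_const _ K(2)])
  show "affine_on K (\<lambda>x. \<Sum>j<N. \<phi> j x)"
    by (intro affine_on_sum nodal_affine_on K)
  fix q assume "q extreme_point_of K"
  then have "q \<in> mesh_vertices T" using K vertex_in_mesh_vertices by blast
  then have "(\<Sum>j<N. \<phi> j q) = (\<Sum>j<N. if q = z j then 1 else 0)"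
    by (simp add: nodal_at_vertex)
  also have "\<dots> = real (card {j\<in>{..<N}. q = z j})"
    by (simp add: sum.If_cases Int_def)
  also have "\<dots> \<le> 1"
  proof -
    have "i = j" if "i \<in> {j\<in>{..<N}. q = z j}" "j \<in> {j\<in>{..<N}. q = z j}" for i j
      using that enum unfolding bij_betw_def inj_on_def by blast
    then have "card {j\<in>{..<N}. q = z j} \<le> Suc 0"
      by (intro card_le_Suc0_iff_eq[THEN iffD2]) auto
    then show ?thesis by simp
  qed
  finally show "(\<Sum>j<N. \<phi> j q) \<le> 1" .
qed

text \<open>Split \<open>mass j k\<close> into cell integrals. They are nonnegative, vanish unless
  both nodes lie in the cell, and sum over \<open>j\<close> and \<open>k\<close> to the integral of
  the squared nodal sum, at most the measure of the cell. Hence \<open>w\<close> needs control only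
  for nodes sharing a cell. Both consistency and the upper norm bound rest on this.\<close>

lemma mass_weighted_sum_le:
  assumes w: "\<And>K j k. K \<in> T \<Longrightarrow> j < N \<Longrightarrow> k < N \<Longrightarrow> z j \<in> K \<Longrightarrow> z k \<in> K \<Longrightarrow> \<bar>w j k\<bar> \<le> B K"
    and B: "\<And>K. K \<in> T \<Longrightarrow> 0 \<le> B K"
  shows "\<bar>\<Sum>j<N. \<Sum>k<N. mass j k * w j k\<bar> \<le> (\<Sum>K\<in>T. measure lebesgue K * B K)"
proof -
  define m where "m K j k = (LINT x:K|lebesgue. \<phi> j x * \<phi> k x)" for K j k
  have mass: "mass j k = (\<Sum>K\<in>T. m K j k)" for j k
    unfolding m_def by (intro l2_inner_cells nodal_pw_affine)
  have int: "set_integrable lebesgue K (\<lambda>x. \<phi> j x * \<phi> k x)" if "K \<in> T" for K j k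
    using that by (intro set_integrable_compact_lebesgue continuous_on_mult
        affine_on_continuous nodal_affine_on cell_compact)
  have nonneg: "0 \<le> m K j k" if "K \<in> T" for K j k
    unfolding m_def set_lebesgue_integral_def using nodal_nonneg[OF that]
    by (intro integral_nonneg_AE AE_I2) (auto simp: indicator_def)
  have zero: "m K j k = 0" if "K \<in> T" "z j \<notin> K \<or> z k \<notin> K" for K j k
  proof -
    have "indicator K x *\<^sub>R (\<phi> j x * \<phi> k x) = 0" for x
      using nodal_zero_off_patch[OF that(1)] that(2) by (auto simp: indicator_def)
    then show ?thesis unfolding m_def set_lebesgue_integral_def by (simp only:) simp
  qed
  have total: "(\<Sum>j<N. \<Sum>k<N. m K j k) \<le> measure lebesgue K" if K: "K \<in> T" for K
  proof -
    have "(\<Sum>j<N. \<Sum>k<N. m K j k) =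
        (\<integral>x. (\<Sum>j<N. \<Sum>k<N. indicator K x *\<^sub>R (\<phi> j x * \<phi> k x)) \<partial>lebesgue)"
      unfolding m_def set_lebesgue_integral_def using int[OF K]
      by (intro integral_double_sum[symmetric]) (simp only: set_integrable_def)
    also have "\<dots> \<le> (\<integral>x. indicator K x \<partial>lebesgue)"
    proof (rule integral_mono)
      show "integrable lebesgue (\<lambda>x. \<Sum>j<N. \<Sum>k<N. indicator K x *\<^sub>R (\<phi> j x * \<phi> k x))"
        using int[OF K] unfolding set_integrable_def
        by (intro Bochner_Integration.integrable_sum)
      show "integrable lebesgue (indicator K :: 'a \<Rightarrow> real)"
        using set_integrable_compact_lebesgue[OF cell_compact[OF K] continuous_on_const, of 1]
        by (simp add: set_integrable_def)
      show "(\<Sum>j<N. \<Sum>k<N. indicator K x *\<^sub>R (\<phi> j x * \<phi> k x)) \<le> indicator K x" for x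
      proof (cases "x \<in> K")
        case True
        have "(\<Sum>j<N. \<Sum>k<N. \<phi> j x * \<phi> k x) = (\<Sum>j<N. \<phi> j x) * (\<Sum>k<N. \<phi> k x)"
          by (simp add: sum_product)
        also have "\<dots> \<le> 1 * 1"
          using sum_nodal_le_1[OF K True] nodal_nonneg[OF K True]
          by (intro mult_mono sum_nonneg) auto
        finally show ?thesis using True by simp
      qed simp
    qed
    also have "\<dots> = measure lebesgue K" by simp
    finally show ?thesis .
  qed
  have "(\<Sum>j<N. \<Sum>k<N. mass j k * w j k) = (\<Sum>j<N. \<Sum>k<N. \<Sum>K\<in>T. m K j k * w j k)"
    by (simp add: mass sum_distrib_right)
  also have "\<dots> = (\<Sum>j<N. \<Sum>K\<in>T. \<Sum>k<N. m K j k * w j k)"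
    by (intro sum.cong refl sum.swap)
  also have "\<dots> = (\<Sum>K\<in>T. \<Sum>j<N. \<Sum>k<N. m K j k * w j k)"
    by (rule sum.swap)
  also have "\<bar>\<dots>\<bar> \<le> (\<Sum>K\<in>T. measure lebesgue K * B K)"
  proof (rule order_trans[OF sum_abs sum_mono])
    fix K assume K: "K \<in> T"
    have "\<bar>\<Sum>j<N. \<Sum>k<N. m K j k * w j k\<bar> \<le> (\<Sum>j<N. \<Sum>k<N. \<bar>m K j k * w j k\<bar>)"
      by (rule order_trans[OF sum_abs sum_mono]) (rule sum_abs)
    also have "\<dots> \<le> (\<Sum>j<N. \<Sum>k<N. m K j k * B K)"
    proof (intro sum_mono)
      fix j k assume "j \<in> {..<N}" "k \<in> {..<N}"
      \<comment> \<open>With a node off \<open>K\<close> the weight is 0; otherwise the assumption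
        on \<open>w\<close> applies.\<close>
      then show "\<bar>m K j k * w j k\<bar> \<le> m K j k * B K"
        using nonneg[OF K, of j k] zero[OF K, of j k] w[OF K, of j k]
        by (cases "z j \<in> K \<and> z k \<in> K") (auto simp: abs_mult intro: mult_left_mono)
    qed
    also have "\<dots> = (\<Sum>j<N. \<Sum>k<N. m K j k) * B K"
      by (simp add: sum_distrib_right)
    also have "\<dots> \<le> measure lebesgue K * B K"
      by (intro mult_right_mono total B K)
    finally show "\<bar>\<Sum>j<N. \<Sum>k<N. m K j k * w j k\<bar> \<le> measure lebesgue K * B K" .
  qed
  finally show ?thesis .
qed

section \<open>Consistency of second order\<close>

lemma lumped_consistency:
  assumes u: "u \<in> V" and v: "v \<in> V"
  shows "\<bar>l2_inner S u v - lumped_inner S N \<phi> l u v\<bar>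
    \<le> (1/2) * (mesh_size T)\<^sup>2 * h1_seminorm S u * h1_seminorm S v"
proof -
  have "\<exists>a b. \<forall>x\<in>K. u x = inner a x + b" "\<exists>a b. \<forall>x\<in>K. v x = inner a x + b" if "K \<in> T" for K
    using fe_space_pw_affine[OF u] fe_space_pw_affine[OF v] that
    unfolding pw_affine_def affine_on_def by blast+
  then obtain a b a' b' where a: "\<And>K x. K \<in> T \<Longrightarrow> x \<in> K \<Longrightarrow> u x = inner (a K) x + b K"
    and a': "\<And>K x. K \<in> T \<Longrightarrow> x \<in> K \<Longrightarrow> v x = inner (a' K) x + b' K"
    by metis
  define w where "w j k = (if \<bar>int j - int k\<bar> \<le> int l then 0
    else (u (z j) - u (z k)) * (v (z j) - v (z k)))" for j k
  define h where "h = mesh_size T"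
  have incr: "\<bar>inner p x - inner p y\<bar> \<le> norm p * h" if "K \<in> T" "x \<in> K" "y \<in> K" for p x y K
  proof -
    have "\<bar>inner p (x - y)\<bar> \<le> norm p * norm (x - y)" by (rule Cauchy_Schwarz_ineq2)
    also have "\<dots> \<le> norm p * h"
      unfolding h_def using dist_le_mesh_size[OF that] by (intro mult_left_mono) auto
    finally show ?thesis by (simp add: inner_diff_right)
  qed
  have "\<bar>\<Sum>j<N. \<Sum>k<N. mass j k * w j k\<bar> \<le>
      (\<Sum>K\<in>T. measure lebesgue K * (h\<^sup>2 * norm (a K) * norm (a' K)))"
  proof (rule mass_weighted_sum_le)
    fix K j k assume K: "K \<in> T" "z j \<in> K" "z k \<in> K"
    have "\<bar>(u (z j) - u (z k)) * (v (z j) - v (z k))\<bar> \<le> (norm (a K) * h) * (norm (a' K) * h)"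
      unfolding abs_mult using incr[OF K, of "a K"] incr[OF K, of "a' K"] a[OF K(1)] a'[OF K(1)] K(2,3)
      by (intro mult_mono) (auto intro: order_trans[OF abs_ge_zero])
    then show "\<bar>w j k\<bar> \<le> h\<^sup>2 * norm (a K) * norm (a' K)"
      unfolding w_def by (auto simp: power2_eq_square mult_ac)
  qed simp
  \<comment> \<open>The measure is split into two square roots, one for each gradient, and absolute
    values are inserted to fit \<open>L2_set_mult_ineq\<close>.\<close>
  also have "\<dots> = h\<^sup>2 * (\<Sum>K\<in>T. \<bar>sqrt (measure lebesgue K) * norm (a K)\<bar> *
      \<bar>sqrt (measure lebesgue K) * norm (a' K)\<bar>)"
    unfolding sum_distrib_left by (intro sum.cong refl) (simp add: abs_mult measure_nonneg mult_ac)
  also have "\<dots> \<le> h\<^sup>2 * (h1_seminorm S u * h1_seminorm S v)"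
  proof (rule mult_left_mono)
    have seminorms: "h1_seminorm S u = L2_set (\<lambda>K. sqrt (measure lebesgue K) * norm (a K)) T"
      "h1_seminorm S v = L2_set (\<lambda>K. sqrt (measure lebesgue K) * norm (a' K)) T"
      by (rule h1_seminorm_cells[of u a b], erule (1) a)
        (rule h1_seminorm_cells[of v a' b'], erule (1) a')
    show "(\<Sum>K\<in>T. \<bar>sqrt (measure lebesgue K) * norm (a K)\<bar> *
        \<bar>sqrt (measure lebesgue K) * norm (a' K)\<bar>) \<le> h1_seminorm S u * h1_seminorm S v"
      unfolding seminorms by (rule L2_set_mult_ineq)
  qed simp
  finally have "\<bar>\<Sum>j<N. \<Sum>k<N. mass j k * w j k\<bar> \<le> h\<^sup>2 * (h1_seminorm S u * h1_seminorm S v)" .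
  then show ?thesis
    unfolding l2_inner_minus_lumped[OF u v] w_def[symmetric] h_def[symmetric]
    by (simp add: abs_mult mult_ac)
qed

section \<open>Equivalence of the norms\<close>

lemma mass_nonneg: "0 \<le> mass j k"
  unfolding l2_inner_cells[OF nodal_pw_affine nodal_pw_affine] set_lebesgue_integral_def
  by (intro sum_nonneg integral_nonneg_AE AE_I2) (auto simp: indicator_def nodal_nonneg)

text \<open>For \<open>v = u\<close> the increments in the error identity are squares with
  nonnegative weights, behind the factor \<open>- (1/2)\<close>.\<close>

lemma l2_le_lumped:
  assumes u: "u \<in> V"
  shows "l2_inner S u u \<le> lumped_inner S N \<phi> l u u"
proof -
  have "0 \<le> (\<Sum>j<N. \<Sum>k<N. mass j k *
      (if \<bar>int j - int k\<bar> \<le> int l then 0 else (u (z j) - u (z k)) * (u (z j) - u (z k))))"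
    by (intro sum_nonneg mult_nonneg_nonneg mass_nonneg) auto
  then show ?thesis using l2_inner_minus_lumped[OF u u, of l] by linarith
qed

text \<open>Each term in the expansion is a weight times a product of two nodal values of
  \<open>u\<close>, so on a cell the square of its maximum bounds the product. Convexity of the
  cells then gives a constant depending on the dimension alone.\<close>

lemma lumped_le_l2:
  assumes u: "u \<in> V"
  shows "lumped_inner S N \<phi> l u u \<le> 4 ^ (DIM('a) + 1) * l2_inner S u u"
proof -
  have aff: "affine_on K u" if "K \<in> T" for K
    using fe_space_pw_affine[OF u] that unfolding pw_affine_def by blast
  \<comment> \<open>Chosen so that \<open>measure lebesgue K * B K\<close> is a multiple of the cell
    integral and still dominates \<open>(u x)\<^sup>2\<close> on \<open>K\<close>.\<close>
  define B where "B K = 4 ^ (DIM('a) + 1) * (LINT x:K|lebesgue. u x * u x) / measure lebesgue K" for K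
  have sq: "(u x)\<^sup>2 \<le> B K" if "K \<in> T" "x \<in> K" for K x
    using affine_on_square_le_integral[OF cell_compact cell_convex aff that(2)] that(1)
      cell_measure_pos[OF that(1)]
    unfolding B_def by (simp add: le_divide_eq)
  have "lumped_inner S N \<phi> l u u \<le> (\<Sum>K\<in>T. measure lebesgue K * B K)"
    unfolding lumped_inner_expand[OF u u]
  proof (rule order_trans[OF abs_ge_self mass_weighted_sum_le])
    fix K j k assume K: "K \<in> T" "z j \<in> K" "z k \<in> K"
    have "0 \<le> B K" using sq[OF K(1,2)] by (rule order_trans[OF zero_le_power2])
    have "\<bar>u x\<bar> \<le> sqrt (B K)" if "x \<in> K" for x
      using sq[OF K(1) that] real_le_rsqrt by (metis power2_abs)
    then have *: "\<bar>u x * u y\<bar> \<le> sqrt (B K) * sqrt (B K)" if "x \<in> K" "y \<in> K" for x y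
      unfolding abs_mult using that \<open>0 \<le> B K\<close> by (intro mult_mono) auto
    show
      "\<bar>u (z j) * (if \<bar>int j - int k\<bar> \<le> int l then u (z k) else u (z j))\<bar> \<le> B K"
      using *[OF K(2,2)] *[OF K(2,3)] \<open>0 \<le> B K\<close> by simp
  next
    fix K assume "K \<in> T"
    then show "0 \<le> B K"
      unfolding B_def set_lebesgue_integral_def by (intro divide_nonneg_nonneg mult_nonneg_nonneg) auto
  qed
  also have "\<dots> = (\<Sum>K\<in>T. 4 ^ (DIM('a) + 1) * (LINT x:K|lebesgue. u x * u x))"
    unfolding B_def using cell_measure_pos by (intro sum.cong refl) force
  also have "\<dots> = 4 ^ (DIM('a) + 1) * l2_inner S u u"
    unfolding l2_inner_cells[OF fe_space_pw_affine[OF u] fe_space_pw_affine[OF u]]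
    by (simp add: sum_distrib_left)
  finally show ?thesis .
qed

section \<open>The inner product axioms\<close>

lemma l2_inner_self_nonneg: "0 \<le> l2_inner S u u"
  unfolding l2_inner_def set_lebesgue_integral_def by simp

lemma lumped_inner_product: "inner_product_on V (lumped_inner S N \<phi> l)"
  unfolding inner_product_on_def
proof (intro conjI ballI allI)
  fix u v assume u: "u \<in> V" and v: "v \<in> V"
  \<comment> \<open>The expansion of the lumped form is not symmetric term by term inside the band,
    but the error identity is.\<close>
  have "l2_inner S u v - lumped_inner S N \<phi> l u v = l2_inner S v u - lumped_inner S N \<phi> l v u"
    unfolding l2_inner_minus_lumped[OF u v] l2_inner_minus_lumped[OF v u]
    by (simp add: mult.commute cong: if_cong)
  moreover have "l2_inner S u v = l2_inner S v u"
    unfolding l2_inner_def by (simp add: mult.commute)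
  ultimately show "lumped_inner S N \<phi> l u v = lumped_inner S N \<phi> l v u" by simp
next
  fix u v w assume u: "u \<in> V" and v: "v \<in> V" and w: "w \<in> V"
  show "lumped_inner S N \<phi> l (\<lambda>x. u x + v x) w =
      lumped_inner S N \<phi> l u w + lumped_inner S N \<phi> l v w"
    unfolding lumped_inner_expand[OF fe_space_add[OF u v] w] lumped_inner_expand[OF u w]
      lumped_inner_expand[OF v w] sum.distrib[symmetric]
    by (intro sum.cong refl) (simp add: algebra_simps)
next
  fix c u v assume u: "u \<in> V" and v: "v \<in> V"
  show "lumped_inner S N \<phi> l (\<lambda>x. c * u x) v = c * lumped_inner S N \<phi> l u v"
    unfolding lumped_inner_expand[OF fe_space_cmult[OF u] v] lumped_inner_expand[OF u v]
      sum_distrib_left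
    by (intro sum.cong refl) (simp add: mult_ac)
next
  fix u assume u: "u \<in> V"
  show "0 \<le> lumped_inner S N \<phi> l u u"
    using l2_inner_self_nonneg l2_le_lumped[OF u] by (rule order_trans)
  show "(lumped_inner S N \<phi> l u u = 0) = (u = (\<lambda>x. 0))"
  proof
    assume "lumped_inner S N \<phi> l u u = 0"
    then show "u = (\<lambda>x. 0)"
      using l2_le_lumped[OF u, of l] pw_affine_l2_zero[OF fe_space_pw_affine[OF u]] by simp
  next
    assume "u = (\<lambda>x. 0)"
    then show "lumped_inner S N \<phi> l u u = 0"
      unfolding lumped_inner_expand[OF u u] by simp
  qed
qed

end

section \<open>Uniform constants for the whole family\<close>

theorem proposition3p7:
  fixes S :: "'a::euclidean_space set"
    and bc :: boundary_condition
    and H :: "real set"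
    and T :: "real \<Rightarrow> 'a set set"
    and z :: "real \<Rightarrow> nat \<Rightarrow> 'a"
  assumes dim: "DIM('a) \<in> {1, 2, 3}"
    and domain: "S \<noteq> {}" "open S" "bounded S" "convex S" "polytope (closure S)"
    and mesh: "\<And>h. h \<in> H \<Longrightarrow> conforming_mesh S (T h)"
    and size: "\<And>h. h \<in> H \<Longrightarrow> mesh_size (T h) = h"
    and refine: "0 islimpt H"
    and regular: "shape_regular H T"
    and enum: "\<And>h. h \<in> H \<Longrightarrow>
      bij_betw (z h) {..<fe_dim bc S (T h)} (active_vertices bc S (T h))"
  shows "admissible_inner_products S
    {(h, l). h \<in> H \<and> l < fe_dim bc S (T h)}
    (\<lambda>(h, l). h)
    (\<lambda>(h, l). fe_space bc S (T h))
    (\<lambda>(h, l). lumped_inner S (fe_dim bc S (T h)) (\<lambda>j. nodal_function (T h) (z h j)) l)"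
proof -
  \<comment> \<open>The locale is entered for each \<open>h\<close> with \<open>N\<close> equal to
    \<open>fe_dim\<close>; its bounds hold for every bandwidth, so the constants below are uniform
    in \<open>h\<close> and \<open>l\<close>.\<close>
  have basis: "nodal_basis S (T h) bc (fe_dim bc S (T h)) (z h)" if "h \<in> H" for h
    using that domain mesh enum by unfold_locales auto
  show ?thesis
    unfolding admissible_inner_products_def
  proof (intro conjI)
    show "\<exists>C. \<forall>i\<in>{(h, l). h \<in> H \<and> l < fe_dim bc S (T h)}.
        \<forall>u\<in>case i of (h, l) \<Rightarrow> fe_space bc S (T h). \<forall>v\<in>case i of (h, l) \<Rightarrow> fe_space bc S (T h).
        \<bar>l2_inner S u v - (case i of (h, l) \<Rightarrow>
          lumped_inner S (fe_dim bc S (T h)) (\<lambda>j. nodal_function (T h) (z h j)) l) u v\<bar>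
        \<le> C * (case i of (h, l) \<Rightarrow> h)\<^sup>2 * h1_seminorm S u * h1_seminorm S v"
      by (rule exI[of _ "1/2"]) (use nodal_basis.lumped_consistency[OF basis] size in force)
    show "\<exists>C. \<forall>i\<in>{(h, l). h \<in> H \<and> l < fe_dim bc S (T h)}.
        \<forall>u\<in>case i of (h, l) \<Rightarrow> fe_space bc S (T h).
        sqrt ((case i of (h, l) \<Rightarrow>
          lumped_inner S (fe_dim bc S (T h)) (\<lambda>j. nodal_function (T h) (z h j)) l) u u)
        \<le> C * l2_norm S u"
      \<comment> \<open>The square root of the constant in \<open>lumped_le_l2\<close>, which
        compares squared norms.\<close>
      by (rule exI[of _ "sqrt (4 ^ (DIM('a) + 1))"])
        (use nodal_basis.lumped_le_l2[OF basis] in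
          \<open>auto simp: l2_norm_def real_sqrt_mult[symmetric] simp del: power_Suc\<close>)
    show "\<exists>C. \<forall>i\<in>{(h, l). h \<in> H \<and> l < fe_dim bc S (T h)}.
        \<forall>u\<in>case i of (h, l) \<Rightarrow> fe_space bc S (T h).
        l2_norm S u \<le> C * sqrt ((case i of (h, l) \<Rightarrow>
          lumped_inner S (fe_dim bc S (T h)) (\<lambda>j. nodal_function (T h) (z h j)) l) u u)"
      \<comment> \<open>Lumping never decreases the norm, hence the constant 1.\<close>
      by (rule exI[of _ 1])
        (use nodal_basis.l2_le_lumped[OF basis] in \<open>auto simp: l2_norm_def\<close>)
  qed (use nodal_basis.lumped_inner_product[OF basis] in auto)
qed

end
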